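(* Let $n$ be any positive integer. Then $$\tau(n)=\tfrac{1}{2^3\cdot3^5\cdot5\cdot7}\left[3\cdot7\cdot691\,\sigma_3(n)+2^3\cdot5\cdot691\,\sigma_5(n)+2\cdot3\cdot7\cdot691\,\sigma_7(n)-13\cdot241\,\sigma_{11}(n)\right]$$ $$\qquad+\tfrac{691\cdot2^2}{3^3}\sum_{m=1}^{n-1}\left[\sigma_3(m)\sigma_7(n-m)-\sigma_5(m)\sigma_5(n-m)\right]$$ and $$\tau(n)=\tfrac{1}{2^3\cdot3^5\cdot5\cdot7}\sum_{d\mid n,\,d>0}d^3\left(3\cdot7\cdot691+2^3\cdot5\cdot691\,d^2+2\cdot3\cdot7\cdot691\,d^4-13\cdot241\,d^8\right)$$ $$\qquad+\tfrac{691\cdot2^2}{3^3}\sum_{\substack{m_1>m_2\ge1\\ m_1+m_2\le n\\ \gcd(m_1,m_2)\mid n}}(m_1m_2)^3(m_1^2-m_2^2)^2\sum_{\substack{y_1,y_2\ge1\\ m_1y_1+m_2y_2=n}}1,$$ where $m_1,m_2,y_1,y_2$ range over integers.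
   Context: Ramanujan's tau function $\tau(n)$ is defined by $q\prod_{r\ge1}(1-q^r)^{24}=\sum_{n=1}^{\infty}\tau(n)q^n$. For positive integers $r,n$, $\sigma_r(n):=\sum_{d\mid n,\,d>0}d^r$. *)

theory Defs
  imports "HOL-Analysis.Infinite_Products" "HOL-Computational_Algebra.Formal_Power_Series"
begin

text \<open>The infinite product is taken in the ring of formal power series over the integers, with its
  usual (coefficientwise) topology; the factor for \<open>r \<ge> 1\<close> has index \<open>r - 1\<close>.\<close>

definition ramanujan_tau :: "nat \<Rightarrow> int" where
  "ramanujan_tau n = fps_nth (fps_X * (\<Prod>r. (1 - fps_X ^ Suc r) ^ 24)) n"

definition divisor_sigma :: "nat \<Rightarrow> nat \<Rightarrow> nat" where
  "divisor_sigma r n = (\<Sum>d | d dvd n. d ^ r)"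

text \<open>The product defining \<^const>\<open>ramanujan_tau\<close> converges, so \<^const>\<open>prodinf\<close> is its genuine value.\<close>

lemma ramanujan_tau_has_prod:
  "(\<lambda>r. (1 - fps_X ^ Suc r) ^ 24 :: int fps) has_prod (\<Prod>r. (1 - fps_X ^ Suc r) ^ 24)"
proof -
  define f :: "nat \<Rightarrow> int fps" where "f = (\<lambda>r. (1 - fps_X ^ Suc r) ^ 24)"
  define P where "P = (\<lambda>n. \<Prod>i\<le>n. f i)"
  define L where "L = Abs_fps (\<lambda>n. fps_nth (P n) n)"
  have dvd: "fps_X ^ Suc r dvd f r - 1" for r
  proof -
    have "y dvd (1 - y) ^ k - 1" for y :: "int fps" and k
    proof (induction k)
      case (Suc k)
      have "(1 - y) ^ Suc k - 1 = ((1 - y) ^ k - 1) - y * (1 - y) ^ k" by (simp add: algebra_simps)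
      with Suc show ?case by (metis dvd_diff dvd_triv_left)
    qed simp
    thus ?thesis unfolding f_def .
  qed
  have step: "fps_nth (P (Suc N)) n = fps_nth (P N) n" if "n \<le> N" for n N
  proof -
    obtain g where g: "f (Suc N) - 1 = fps_X ^ Suc (Suc N) * g" using dvd unfolding dvd_def by blast
    have "P (Suc N) = P N + fps_X ^ Suc (Suc N) * (P N * g)"
      using g by (simp add: P_def algebra_simps)
    thus ?thesis using that by (simp add: fps_X_power_mult_nth del: power_Suc)
  qed
  have stable: "fps_nth (P N) n = fps_nth (P n) n" if "n \<le> N" for n N
    using that by (induction N rule: dec_induct) (simp_all add: step)
  have "P \<longlonglongrightarrow> L"
  proof (rule tendsto_fpsI)
    fix n
    show "eventually (\<lambda>N. fps_nth (P N) n = fps_nth L n) sequentially"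
      using eventually_ge_at_top [of n]
      by eventually_elim (metis L_def fps_nth_Abs_fps stable)
  qed
  moreover have "fps_nth L 0 = 1"
    by (simp add: L_def P_def f_def fps_nth_power_0 del: power_Suc)
  hence "L \<noteq> 0" by auto
  ultimately have "f has_prod L"
    by (simp add: has_prod_def raw_has_prod_def P_def [abs_def])
  thus ?thesis
    using has_prod_unique unfolding f_def by metis
qed

end

theory Submission
  imports Defs
begin

text \<open>With \<open>Q = E\<^sub>4\<close> and \<open>R = E\<^sub>6\<close>, the discriminant identity \<open>1728 \<Sum>\<tau>(n)q^n = Q\<^sup>3 - R\<^sup>2\<close>, the identity
  \<open>Q\<^sup>2 = E\<^sub>8\<close> and \<open>691 E\<^sub>1\<^sub>2 = 441 Q\<^sup>3 + 250 R\<^sup>2\<close> determine \<open>\<tau>\<close> from \<open>QE\<^sub>8\<close>, \<open>R\<^sup>2\<close> and divisor sums; the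
  second formula for \<open>\<tau>\<close> then comes from symmetrizing the convolutions over \<open>ax + by = n\<close>. The
  Eisenstein identities need no modular forms: each one is an instance of an elementary identity
  for sums of an even function \<open>f(a, b)\<close> over the positive solutions of \<open>ax + by = n\<close>, with \<open>f\<close> a
  homogeneous polynomial. The same identity gives Ramanujan's equations
  \<open>3 qQ' = E\<^sub>2Q - R\<close> and \<open>2 qR' = E\<^sub>2R - Q\<^sup>2\<close>, so that \<open>Q\<^sup>3 - R\<^sup>2\<close> satisfies \<open>qF' = E\<^sub>2F\<close>. The product
  defining \<open>\<tau>\<close> satisfies this equation as well, by logarithmic differentiation, and its
  solution is determined by the coefficient of \<open>q\<close>.\<close>

subsection \<open>Sums over the positive solutions of ax + by = n\<close>

text \<open>Integers are used because the arguments a - b, b - a and -b of the functions summed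
  below can be negative.\<close>

definition quads :: "int \<Rightarrow> (int \<times> int \<times> int \<times> int) set" where
  "quads n = {(a, b, x, y). a > 0 \<and> b > 0 \<and> x > 0 \<and> y > 0 \<and> a * x + b * y = n}"

definition quad_sum :: "int \<Rightarrow> (int \<Rightarrow> int \<Rightarrow> int \<Rightarrow> int \<Rightarrow> real) \<Rightarrow> real" where
  "quad_sum n F = (\<Sum>(a, b, x, y)\<in>quads n. F a b x y)"

lemma finite_quads: "finite (quads n)"
proof (rule finite_subset)
  show "quads n \<subseteq> {1..n} \<times> {1..n} \<times> {1..n} \<times> {1..n}"
  proof
    fix t assume "t \<in> quads n"
    then obtain a b x y where t: "t = (a, b, x, y)" and
      *: "a > 0" "b > 0" "x > 0" "y > 0" "a * x + b * y = n" by (auto simp: quads_def)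
    have "a \<le> a * x" "x \<le> a * x" "b \<le> b * y" "y \<le> b * y" "0 < a * x" "0 < b * y"
      using * by (auto simp: mult_le_cancel_left1 mult_le_cancel_right1)
    hence "a \<le> n" "b \<le> n" "x \<le> n" "y \<le> n" using *(5) by linarith+
    thus "t \<in> {1..n} \<times> {1..n} \<times> {1..n} \<times> {1..n}" using t * by simp
  qed
qed auto

lemma quad_sum_cong:
  assumes "\<And>a b x y. \<lbrakk>a > 0; b > 0; x > 0; y > 0; a * x + b * y = n\<rbrakk> \<Longrightarrow> F a b x y = G a b x y"
  shows "quad_sum n F = quad_sum n G"
  unfolding quad_sum_def by (rule sum.cong) (auto simp: quads_def assms)

lemma quad_sum_add:
  "quad_sum n (\<lambda>a b x y. F a b x y + G a b x y) = quad_sum n F + quad_sum n G"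
  by (simp add: quad_sum_def case_prod_unfold sum.distrib)

lemma quad_sum_diff:
  "quad_sum n (\<lambda>a b x y. F a b x y - G a b x y) = quad_sum n F - quad_sum n G"
  by (simp add: quad_sum_def case_prod_unfold sum_subtractf)

lemma quad_sum_mult:
  "quad_sum n (\<lambda>a b x y. c * F a b x y) = c * quad_sum n F"
  by (simp add: quad_sum_def case_prod_unfold sum_distrib_left)

lemma quad_sum_swap: "quad_sum n F = quad_sum n (\<lambda>a b x y. F b a y x)"
  unfolding quad_sum_def
  by (rule sum.reindex_bij_witness[of _ "\<lambda>(a, b, x, y). (b, a, y, x)" "\<lambda>(a, b, x, y). (b, a, y, x)"])
     (auto simp: quads_def)

text \<open>The shear preserves the form: (a + b)x + b(y - x) = ax + by. Positivity of y - x is the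
  condition x < y, and positivity of the old a is the condition b < a on the new one.\<close>

lemma quad_sum_shear:
  "quad_sum n (\<lambda>a b x y. if x < y then g a b else 0) =
   quad_sum n (\<lambda>a b x y. if b < a then g (a - b) b else 0)"
proof -
  let ?A = "{t \<in> quads n. case t of (a, b, x, y) \<Rightarrow> x < y}"
  let ?B = "{t \<in> quads n. case t of (a, b, x, y) \<Rightarrow> b < a}"
  have "quad_sum n (\<lambda>a b x y. if x < y then g a b else 0) = (\<Sum>(a, b, x, y)\<in>?A. g a b)"
    unfolding quad_sum_def by (subst sum.inter_filter[OF finite_quads]) (auto intro!: sum.cong)
  also have "\<dots> = (\<Sum>(a, b, x, y)\<in>?B. g (a - b) b)"
    by (rule sum.reindex_bij_witness[of _ "\<lambda>(a, b, x, y). (a - b, b, x, x + y)"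
              "\<lambda>(a, b, x, y). (a + b, b, x, y - x)"])
       (auto simp: quads_def algebra_simps)
  also have "\<dots> = quad_sum n (\<lambda>a b x y. if b < a then g (a - b) b else 0)"
    unfolding quad_sum_def by (subst sum.inter_filter[OF finite_quads]) (auto intro!: sum.cong)
  finally show ?thesis .
qed

lemma quad_sum_split:
  "quad_sum n F = quad_sum n (\<lambda>a b x y. if p a b x y < q a b x y then F a b x y else 0)
     + quad_sum n (\<lambda>a b x y. if q a b x y < p a b x y then F a b x y else 0)
     + quad_sum n (\<lambda>a b x y. if p a b x y = (q a b x y :: int) then F a b x y else 0)"
  unfolding quad_sum_add[symmetric] by (rule quad_sum_cong) auto

text \<open>The shear \<open>(a, b, x, y) \<mapsto> (a + b, b, x, y - x)\<close> trades the condition \<open>x < y\<close> for \<open>b < a\<close>. After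
  splitting every sum by comparing \<open>a\<close> with \<open>b\<close> or \<open>x\<close> with \<open>y\<close>, shears and swaps cancel all
  terms except those with \<open>a = b\<close> or \<open>x = y\<close>.\<close>

lemma quad_sum_even_identity:
  fixes f :: "int \<Rightarrow> int \<Rightarrow> real"
  assumes even: "\<And>a b. f (-a) (-b) = f a b"
  shows "quad_sum n (\<lambda>a b x y. f a b - f a (-b) + f a (a - b) - f a (a + b)
            + f (b - a) b - f (a + b) b) =
         quad_sum n (\<lambda>a b x y. if a = b then f a a + f a 0 + f 0 a else 0)
         - quad_sum n (\<lambda>a b x y. if x = y then f (a + b) b + f a (a + b) + f a (-b) else 0)"
proof -
  let ?Z = "quad_sum n"
  note ab = quad_sum_split[where p = "\<lambda>a b x y. a" and q = "\<lambda>a b x y. b" and n = n]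
  note xy = quad_sum_split[where p = "\<lambda>a b x y. x" and q = "\<lambda>a b x y. y" and n = n]
  \<comment> \<open>The sums of f(a, b), f(a, a - b), f(b - a, b) are split by a against b, those of
    f(a + b, b), f(a, a + b), f(a, -b) by x against y. The equalities that follow match the six
    off-diagonal pieces of one kind with the six of the other. Where the condition is y < x, a swap
    precedes the shear.\<close>
  have f_sum1: "?Z (\<lambda>a b x y. if x < y then f (a + b) b else 0) =
      ?Z (\<lambda>a b x y. if b < a then f a b else 0)"
    using quad_sum_shear[of n "\<lambda>a b. f (a + b) b"] by (simp cong: if_cong)
  have f_sum2: "?Z (\<lambda>a b x y. if y < x then f (a + b) b else 0) =
      ?Z (\<lambda>a b x y. if b < a then f a (a - b) else 0)"
    using quad_sum_swap[of n "\<lambda>a b x y. if y < x then f (a + b) b else 0"]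
      quad_sum_shear[of n "\<lambda>a b. f (b + a) a"] by (simp cong: if_cong)
  have f_sum3: "?Z (\<lambda>a b x y. if x < y then f a (a + b) else 0) =
      ?Z (\<lambda>a b x y. if b < a then f (a - b) a else 0)"
    using quad_sum_shear[of n "\<lambda>a b. f a (a + b)"] by (simp cong: if_cong)
  have f_sum4: "?Z (\<lambda>a b x y. if y < x then f a (a + b) else 0) =
      ?Z (\<lambda>a b x y. if a < b then f a b else 0)"
    using quad_sum_swap[of n "\<lambda>a b x y. if y < x then f a (a + b) else 0"]
      quad_sum_shear[of n "\<lambda>a b. f b (b + a)"]
      quad_sum_swap[of n "\<lambda>a b x y. if a < b then f a b else 0"] by (simp cong: if_cong)
  \<comment> \<open>Evenness enters here: the shear produces \<open>f (a - b) (- b)\<close>, which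
    is \<open>f (b - a) b\<close>.\<close>
  have f_neg1: "?Z (\<lambda>a b x y. if x < y then f a (-b) else 0) =
      ?Z (\<lambda>a b x y. if b < a then f (b - a) b else 0)"
    using quad_sum_shear[of n "\<lambda>a b. f a (- b)"] even[of "a - b" "-b" for a b] by (simp cong: if_cong)
  have f_neg2: "?Z (\<lambda>a b x y. if y < x then f a (-b) else 0) =
      ?Z (\<lambda>a b x y. if a < b then f a (a - b) else 0)"
    using quad_sum_swap[of n "\<lambda>a b x y. if y < x then f a (-b) else 0"]
      quad_sum_shear[of n "\<lambda>a b. f b (-a)"]
      quad_sum_swap[of n "\<lambda>a b x y. if a < b then f a (a - b) else 0"] by (simp cong: if_cong)
  have f_swap: "?Z (\<lambda>a b x y. if a < b then f (b - a) b else 0) =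
      ?Z (\<lambda>a b x y. if b < a then f (a - b) a else 0)"
    using quad_sum_swap[of n "\<lambda>a b x y. if a < b then f (b - a) b else 0"] by (simp cong: if_cong)
  have diag: "?Z (\<lambda>a b x y. if a = b then f a a + f a 0 + f 0 a else 0) =
      ?Z (\<lambda>a b x y. if a = b then f a b else 0) + ?Z (\<lambda>a b x y. if a = b then f a (a - b) else 0)
      + ?Z (\<lambda>a b x y. if a = b then f (b - a) b else 0)"
    unfolding quad_sum_add[symmetric] by (rule quad_sum_cong) auto
  have diag': "?Z (\<lambda>a b x y. if x = y then f (a + b) b + f a (a + b) + f a (-b) else 0) =
      ?Z (\<lambda>a b x y. if x = y then f (a + b) b else 0) + ?Z (\<lambda>a b x y. if x = y then f a (a + b) else 0)
      + ?Z (\<lambda>a b x y. if x = y then f a (-b) else 0)"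
    unfolding quad_sum_add[symmetric] by (rule quad_sum_cong) auto
  show ?thesis
    unfolding quad_sum_add quad_sum_diff diag diag'
    using ab[of "\<lambda>a b x y. f a b"] ab[of "\<lambda>a b x y. f a (a - b)"] ab[of "\<lambda>a b x y. f (b - a) b"]
      xy[of "\<lambda>a b x y. f (a + b) b"] xy[of "\<lambda>a b x y. f a (a + b)"] xy[of "\<lambda>a b x y. f a (-b)"]
      f_sum1 f_sum2 f_sum3 f_sum4 f_neg1 f_neg2 f_swap
    by linarith
qed

text \<open>If a = b = d, then d divides n and x + y = n/d, which has n/d - 1 positive
  solutions.\<close>

lemma quad_sum_diagonal:
  assumes "n \<ge> 1"
  shows "quad_sum (int n) (\<lambda>a b x y. if a = b then g a else 0) =
    (\<Sum>d | d dvd n. (real n / real d - 1) * g (int d))"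
proof -
  let ?A = "{t \<in> quads (int n). case t of (a, b, x, y) \<Rightarrow> a = b}"
  let ?S = "SIGMA d:{d. d dvd n}. {x::int. 0 < x \<and> x < int (n div d)}"
  have fin: "finite {d. d dvd n}" using assms by simp
  have "quad_sum (int n) (\<lambda>a b x y. if a = b then g a else 0) = (\<Sum>(a, b, x, y)\<in>?A. g a)"
    unfolding quad_sum_def by (subst sum.inter_filter[OF finite_quads]) (auto intro!: sum.cong)
  also have "\<dots> = (\<Sum>(d, x)\<in>?S. g (int d))"
  proof (rule sum.reindex_bij_witness[of _ "\<lambda>(d, x). (int d, int d, x, int (n div d) - x)"
            "\<lambda>(a, b, x, y). (nat a, x)"], goal_cases)
    case (2 t)
    then obtain a x y where t: "t = (a, a, x, y)" "0 < a" "0 < x" "0 < y" "a * x + a * y = int n"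
      by (auto simp: quads_def)
    then obtain m where m: "a = int m" by (metis zero_less_imp_eq_int)
    have "int n = int m * (x + y)" using t m by (simp add: algebra_simps)
    moreover from this have "m dvd n" by (metis dvd_triv_left int_dvd_int_iff)
    ultimately show ?case using t m
      by (auto simp: zdiv_int)
  next
    case (1 t)
    then obtain a x y where t: "t = (a, a, x, y)" "0 < a" "0 < x" "0 < y" "a * x + a * y = int n"
      by (auto simp: quads_def)
    then obtain m where m: "a = int m" by (metis zero_less_imp_eq_int)
    have "int n = int m * (x + y)" using t m by (simp add: algebra_simps)
    moreover from this have "m dvd n" by (metis dvd_triv_left int_dvd_int_iff)
    ultimately show ?case using t m
      by (auto simp: zdiv_int)
  next
    case (4 t)
    then obtain d x where "t = (d, x)" "d dvd n" "0 < x" "x < int (n div d)" by auto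
    moreover from this have "d > 0" using assms by (auto intro: Nat.gr0I)
    ultimately show ?case by (auto simp: quads_def algebra_simps simp flip: of_nat_mult)
  qed (auto simp: quads_def)
  also have "\<dots> = (\<Sum>d | d dvd n. (real n / real d - 1) * g (int d))"
  proof (subst sum.Sigma[symmetric, OF fin], goal_cases)
    case 2
    show ?case
    proof (rule sum.cong[OF refl])
      fix d assume "d \<in> {d. d dvd n}"
      hence d: "d dvd n" "d > 0" using assms by (auto intro: Nat.gr0I)
      hence "n div d \<ge> 1" using assms by (simp add: dvd_imp_le div_greater_zero_iff Suc_leI)
      moreover have "{x::int. 0 < x \<and> x < int (n div d)} = {1..<int (n div d)}" by auto
      ultimately show "(\<Sum>x\<in>{x. 0 < x \<and> x < int (n div d)}. g (int d)) =
          (real n / real d - 1) * g (int d)"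
        using d by (simp add: real_of_nat_div)
    qed
  qed auto
  finally show ?thesis .
qed

text \<open>If x = y, then d = a + b divides n with cofactor x, and b runs freely from 1 to d -
  1.\<close>

lemma quad_sum_codiagonal:
  assumes "n \<ge> 1"
  shows "quad_sum (int n) (\<lambda>a b x y. if x = y then h a b else 0) =
    (\<Sum>d | d dvd n. \<Sum>b = 1..<d. h (int d - int b) (int b))"
proof -
  let ?A = "{t \<in> quads (int n). case t of (a, b, x, y) \<Rightarrow> x = y}"
  let ?S = "SIGMA d:{d. d dvd n}. {1..<d}"
  have fin: "finite {d. d dvd n}" using assms by simp
  have "quad_sum (int n) (\<lambda>a b x y. if x = y then h a b else 0) = (\<Sum>(a, b, x, y)\<in>?A. h a b)"
    unfolding quad_sum_def by (subst sum.inter_filter[OF finite_quads]) (auto intro!: sum.cong)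
  also have "\<dots> = (\<Sum>(d, b)\<in>?S. h (int d - int b) (int b))"
  proof (rule sum.reindex_bij_witness[of _
            "\<lambda>(d, b). (int d - int b, int b, int (n div d), int (n div d))"
            "\<lambda>(a, b, x, y). (nat (a + b), nat b)"], goal_cases)
    case (1 t)
    then obtain a b x where t: "t = (a, b, x, x)" "0 < a" "0 < b" "0 < x" "a * x + b * x = int n"
      by (auto simp: quads_def)
    have "int n = (a + b) * x" using t by (simp add: algebra_simps)
    thus ?case using t by (auto simp: zdiv_int)
  next
    case (2 t)
    then obtain a b x where t: "t = (a, b, x, x)" "0 < a" "0 < b" "0 < x" "a * x + b * x = int n"
      by (auto simp: quads_def)
    have "int n = (a + b) * x" using t by (simp add: algebra_simps)
    hence "int (nat (a + b)) dvd int n" using t by simp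
    hence "nat (a + b) dvd n" by (simp only: int_dvd_int_iff)
    thus ?case using t by auto
  next
    case (4 t)
    then obtain d b where t: "t = (d, b)" "d dvd n" "1 \<le> b" "b < d" by auto
    hence "n div d > 0" using assms by (simp add: dvd_imp_le div_greater_zero_iff)
    moreover have "(int d - int b) * int (n div d) + int b * int (n div d) = int d * int (n div d)"
      by (simp add: algebra_simps)
    ultimately show ?case using t by (auto simp: quads_def simp flip: of_nat_mult)
  qed (auto simp: quads_def)
  also have "\<dots> = (\<Sum>d | d dvd n. \<Sum>b = 1..<d. h (int d - int b) (int b))"
    by (subst sum.Sigma[symmetric, OF fin]) auto
  finally show ?thesis .
qed

text \<open>Group the solutions by m = ax: then a is a divisor of m, b is a divisor of n - m, and x,
  y are the cofactors.\<close>

lemma quad_sum_convolution: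
  "quad_sum (int n) (\<lambda>a b x y. real_of_int a ^ i * real_of_int b ^ j) =
    (\<Sum>m = 1..n - 1. real (divisor_sigma i m) * real (divisor_sigma j (n - m)))"
proof -
  let ?S = "SIGMA m:{1..n - 1}. {a. a dvd m} \<times> {b. b dvd n - m}"
  have "quad_sum (int n) (\<lambda>a b x y. real_of_int a ^ i * real_of_int b ^ j) =
      (\<Sum>(m, a, b)\<in>?S. real a ^ i * real b ^ j)"
    unfolding quad_sum_def
  proof (rule sum.reindex_bij_witness[of _
            "\<lambda>(m, a, b). (int a, int b, int (m div a), int ((n - m) div b))"
            "\<lambda>(a, b, x, y). (nat (a * x), nat a, nat b)"], goal_cases)
    case (1 t)
    then obtain a b x y where t: "t = (int a, int b, int x, int y)" "0 < a" "0 < b" "0 < x" "0 < y"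
        "int a * int x + int b * int y = int n"
      by (auto simp: quads_def) (metis zero_less_imp_eq_int)
    have "n - a * x = b * y" using t(6) by (simp flip: of_nat_mult of_nat_add)
    thus ?case using t by (auto simp flip: of_nat_mult)
  next
    case (2 t)
    then obtain a b x y where t: "t = (int a, int b, int x, int y)" "0 < a" "0 < b" "0 < x" "0 < y"
        "int a * int x + int b * int y = int n"
      by (auto simp: quads_def) (metis zero_less_imp_eq_int)
    have "n = a * x + b * y" using t(6) by (simp flip: of_nat_mult of_nat_add)
    moreover have "a * x > 0" "b * y > 0" using t by auto
    ultimately have "n = a * x + b * y" "1 \<le> a * x" "a * x \<le> n - 1" by linarith+
    thus ?case using t by (auto simp flip: of_nat_mult)
  next
    case (3 t)
    thus ?case by (auto simp flip: of_nat_mult)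
  next
    case (4 t)
    then obtain m a b where t: "t = (m, a, b)" "1 \<le> m" "m \<le> n - 1" "a dvd m" "b dvd n - m" by auto
    have "a > 0" "b > 0" using t by (auto intro: Nat.gr0I)
    moreover from this have "m div a > 0" "(n - m) div b > 0"
      using t by (simp_all add: dvd_imp_le div_greater_zero_iff)
    ultimately show ?case using t by (auto simp: quads_def simp flip: of_nat_mult of_nat_add)
  next
    case (5 t)
    thus ?case by (auto simp: quads_def)
  qed
  also have "\<dots> = (\<Sum>m = 1..n - 1. \<Sum>(a, b)\<in>{a. a dvd m} \<times> {b. b dvd n - m}. real a ^ i * real b ^ j)"
    by (subst sum.Sigma[symmetric]) auto
  also have "\<dots> = (\<Sum>m = 1..n - 1. real (divisor_sigma i m) * real (divisor_sigma j (n - m)))"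
    by (simp add: divisor_sigma_def sum_product sum.cartesian_product)
  finally show ?thesis .
qed

subsection \<open>Convolutions of divisor sums\<close>

text \<open>Faulhaber's formulas with last term d - 1. For polynomial \<open>f\<close> the
  codiagonal sums over b reduce to them.\<close>

lemma sum_powers_lessThan:
  fixes d :: nat
  shows "(\<Sum>b<d. real b) = real d^2 / 2 - real d / 2"
    and "(\<Sum>b<d. real b ^ 2) = real d^3 / 3 - real d^2 / 2 + real d / 6"
    and "(\<Sum>b<d. real b ^ 3) = real d^4 / 4 - real d^3 / 2 + real d^2 / 4"
    and "(\<Sum>b<d. real b ^ 4) = real d^5 / 5 - real d^4 / 2 + real d^3 / 3 - real d / 30"
    and "(\<Sum>b<d. real b ^ 5) = real d^6 / 6 - real d^5 / 2 + 5 * real d^4 / 12 - real d^2 / 12"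
    and "(\<Sum>b<d. real b ^ 6) = real d^7 / 7 - real d^6 / 2 + real d^5 / 2 - real d^3 / 6 + real d / 42"
    and "(\<Sum>b<d. real b ^ 7) = real d^8 / 8 - real d^7 / 2 + 7 * real d^6 / 12 - 7 * real d^4 / 24
           + real d^2 / 12"
    and "(\<Sum>b<d. real b ^ 8) = real d^9 / 9 - real d^8 / 2 + 2 * real d^7 / 3 - 7 * real d^5 / 15
           + 2 * real d^3 / 9 - real d / 30"
    and "(\<Sum>b<d. real b ^ 9) = real d^10 / 10 - real d^9 / 2 + 3 * real d^8 / 4 - 7 * real d^6 / 10
           + real d^4 / 2 - 3 * real d^2 / 20"
  by (induction d; simp add: field_simps eval_nat_numeral)+

text \<open>Reduces each application of the even identity to two computations: \<open>g\<close> is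
  its left side expanded, and \<open>r d\<close> is the codiagonal contribution of the divisor d.
  Vanishing on the axes removes two diagonal terms and lets the sum over b start at 0.\<close>

lemma quad_sum_even_polynomial:
  fixes f :: "real \<Rightarrow> real \<Rightarrow> real"
  assumes "n \<ge> 1" and even: "\<And>a b. f (-a) (-b) = f a b"
    and zero: "\<And>a. f a 0 = 0" "\<And>a. f 0 a = 0"
    and g: "\<And>a b. f a b - f a (-b) + f a (a - b) - f a (a + b) + f (b - a) b - f (a + b) b = g a b"
    and r: "\<And>d. d > 0 \<Longrightarrow>
      (\<Sum>b<d. f (real d) (real b) + f (real b) (real d) + f (real d - real b) (- real b)) = r d"
  shows "quad_sum (int n) (\<lambda>a b x y. g (real_of_int a) (real_of_int b)) =
         (\<Sum>d | d dvd n. (real n / real d - 1) * f (real d) (real d) - r d)"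
proof -
  define h where "h = (\<lambda>a b. f (real_of_int a) (real_of_int b))"
  have even': "h (-a) (-b) = h a b" for a b by (simp add: h_def even)
  have r': "(\<Sum>b = 1..<d. h (int d) (int b) + h (int d - int b) (int d) + h (int d - int b) (- int b)) =
      r d"
    if "d > 0" for d
  proof -
    \<comment> \<open>The reflection of b to d - b spares expanding powers of d - b in this
      term.\<close>
    have "(\<Sum>b = 1..<d. f (real d - real b) (real d)) = (\<Sum>b = 1..<d. f (real b) (real d))"
      by (rule sum.reindex_bij_witness[of _ "\<lambda>b. d - b" "\<lambda>b. d - b"]) (auto simp: of_nat_diff)
    hence "(\<Sum>b = 1..<d. h (int d) (int b) + h (int d - int b) (int d) + h (int d - int b) (- int b)) =
        (\<Sum>b = 1..<d. f (real d) (real b) + f (real b) (real d) + f (real d - real b) (- real b))"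
      by (simp add: h_def sum.distrib)
    also have "\<dots> = (\<Sum>b<d. f (real d) (real b) + f (real b) (real d) + f (real d - real b) (- real b))"
      by (rule sum.mono_neutral_left) (auto simp: zero Suc_le_eq)
    finally show ?thesis using r[OF that] by simp
  qed
  have "quad_sum (int n) (\<lambda>a b x y. g (real_of_int a) (real_of_int b)) =
      quad_sum (int n) (\<lambda>a b x y. h a b - h a (-b) + h a (a - b) - h a (a + b)
        + h (b - a) b - h (a + b) b)"
    by (simp add: h_def flip: g)
  also have "\<dots> = (\<Sum>d | d dvd n. (real n / real d - 1) * f (real d) (real d)
      - (\<Sum>b = 1..<d. h (int d) (int b) + h (int d - int b) (int d) + h (int d - int b) (- int b)))"
    unfolding quad_sum_even_identity[of h "int n", OF even']
      quad_sum_diagonal[OF \<open>n \<ge> 1\<close>, of "\<lambda>a. h a a + h a 0 + h 0 a"]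
      quad_sum_codiagonal[OF \<open>n \<ge> 1\<close>, of "\<lambda>a b. h (a + b) b + h a (a + b) + h a (-b)"]
    by (simp add: sum_subtractf h_def zero)
  also have "\<dots> = (\<Sum>d | d dvd n. (real n / real d - 1) * f (real d) (real d) - r d)"
    using \<open>n \<ge> 1\<close> by (intro sum.cong refl arg_cong2[of _ _ _ _ "(-)"] r') (auto intro: dvd_pos_nat)
  finally show ?thesis .
qed

section \<open>Four convolution identities, of weights 6, 8, 8 and 12\<close>

definition sigma_conv :: "nat \<Rightarrow> nat \<Rightarrow> nat \<Rightarrow> real" where
  "sigma_conv i j n = (\<Sum>m = 1..n - 1. real (divisor_sigma i m) * real (divisor_sigma j (n - m)))"

lemma sigma_conv_eq_quad_sum:
  "quad_sum (int n) (\<lambda>a b x y. real_of_int a ^ i * real_of_int b ^ j) = sigma_conv i j n"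
  by (simp add: quad_sum_convolution sigma_conv_def)

lemma sigma_conv_commute: "sigma_conv i j n = sigma_conv j i n"
  unfolding sigma_conv_eq_quad_sum[symmetric]
  by (subst quad_sum_swap) (simp add: mult.commute)

text \<open>In the next four lemmas the polynomial \<open>f\<close> is chosen so that the unwanted convolutions cancel;
  in the last one this removes \<open>sigma_conv 9 1\<close>.\<close>

lemma sigma_conv_3_1:
  assumes "n \<ge> 1"
  shows "-8 * sigma_conv 3 1 n =
    (real n * real (divisor_sigma 3 n)) + 1/30 * real (divisor_sigma 1 n)
    - 1/3 * real (divisor_sigma 3 n) - 7/10 * real (divisor_sigma 5 n)"
proof -
  \<comment> \<open>Here f(d, d) = d^4, and the factor n/d turns it into n d^3. This is the source
    of n sigma_3(n), which becomes a derivative later.\<close>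
  have "quad_sum (int n) (\<lambda>a b x y.
      -6 * (real_of_int a ^ 1 * real_of_int b ^ 3)
      - 2 * (real_of_int a ^ 3 * real_of_int b ^ 1)) =
      (\<Sum>d | d dvd n. (real n / real d - 1) * (real d ^ 3 * real d)
        - (1/3 * real d ^ 3 + 7/10 * real d ^ 5 - 1/30 * real d - real d ^ 4))"
  proof (rule quad_sum_even_polynomial[OF assms, where f = "\<lambda>a b. a ^ 3 * b"], goal_cases)
    \<comment> \<open>Goal 5 is the power sum \<open>r\<close>; it is expanded in powers of b so
      that Faulhaber's formulas apply.\<close>
    case (5 d)
    have *: "?case \<longleftrightarrow>
        (\<Sum>b<d. real b ^ 4 + (3 * real d ^ 2) * real b ^ 2 - (2 * real d) * real b ^ 3) =
        1/3 * real d ^ 3 + 7/10 * real d ^ 5 - 1/30 * real d - real d ^ 4"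
      by (intro arg_cong2[of _ _ _ _ "(=)"] sum.cong refl) (simp add: algebra_simps eval_nat_numeral)
    show ?case
      unfolding * unfolding sum.distrib sum_subtractf sum_distrib_left[symmetric] sum_powers_lessThan
      by (simp add: field_simps eval_nat_numeral)
  qed (simp_all add: algebra_simps eval_nat_numeral)
  also have "\<dots> =
      (\<Sum>d | d dvd n. (real n * real d ^ 3) + 1/30 * real d ^ 1 - 1/3 * real d ^ 3 - 7/10 * real d ^ 5)"
    using assms by (intro sum.cong refl) (auto simp: field_simps eval_nat_numeral)
  also have "\<dots> = (real n * real (divisor_sigma 3 n)) + 1/30 * real (divisor_sigma 1 n)
    - 1/3 * real (divisor_sigma 3 n) - 7/10 * real (divisor_sigma 5 n)"
    by (simp add: divisor_sigma_def sum.distrib sum_subtractf sum_distrib_left[symmetric]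
        sum_divide_distrib[symmetric])
  finally show ?thesis
    unfolding quad_sum_add quad_sum_diff quad_sum_mult sigma_conv_eq_quad_sum
    using sigma_conv_commute[of 1 3 n] by simp
qed

lemma sigma_conv_3_3:
  assumes "n \<ge> 1"
  shows "-18 * sigma_conv 3 3 n =
    3/20 * real (divisor_sigma 3 n) - 3/20 * real (divisor_sigma 7 n)"
proof -
  \<comment> \<open>The coefficients 4 and -4 belong to equal convolutions and cancel. Since f(d, d)
    = 0, no term with a factor n arises.\<close>
  have "quad_sum (int n) (\<lambda>a b x y.
      4 * (real_of_int a ^ 1 * real_of_int b ^ 5)
      - 18 * (real_of_int a ^ 3 * real_of_int b ^ 3)
      - 4 * (real_of_int a ^ 5 * real_of_int b ^ 1)) =
      (\<Sum>d | d dvd n. (real n / real d - 1) * (real d * real d ^ 5 - real d ^ 3 * real d ^ 3)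
        - (3/20 * real d ^ 7 - 3/20 * real d ^ 3))"
  proof (rule quad_sum_even_polynomial[OF assms,
      where f = "\<lambda>a b. a * b ^ 5 - a ^ 3 * b ^ 3"], goal_cases)
    case (5 d)
    have *: "?case \<longleftrightarrow>
        (\<Sum>b<d. (3 * real d) * real b ^ 5 + real d ^ 5 * real b - (3 * real d ^ 2) * real b ^ 4
        - real d ^ 3 * real b ^ 3) =
        3/20 * real d ^ 7 - 3/20 * real d ^ 3"
      by (intro arg_cong2[of _ _ _ _ "(=)"] sum.cong refl) (simp add: algebra_simps eval_nat_numeral)
    show ?case
      unfolding * unfolding sum.distrib sum_subtractf sum_distrib_left[symmetric] sum_powers_lessThan
      by (simp add: field_simps eval_nat_numeral)
  qed (simp_all add: algebra_simps eval_nat_numeral)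
  also have "\<dots> = (\<Sum>d | d dvd n. 3/20 * real d ^ 3 - 3/20 * real d ^ 7)"
    using assms by (intro sum.cong refl) (auto simp: field_simps eval_nat_numeral)
  also have "\<dots> = 3/20 * real (divisor_sigma 3 n) - 3/20 * real (divisor_sigma 7 n)"
    by (simp add: divisor_sigma_def sum.distrib sum_subtractf sum_distrib_left[symmetric]
        sum_divide_distrib[symmetric])
  finally show ?thesis
    unfolding quad_sum_add quad_sum_diff quad_sum_mult sigma_conv_eq_quad_sum
    using sigma_conv_commute[of 1 5 n] by simp
qed

lemma sigma_conv_5_1:
  assumes "n \<ge> 1"
  shows "-108 * sigma_conv 5 1 n =
    9 * (real n * real (divisor_sigma 5 n)) - 3/14 * real (divisor_sigma 1 n)
    - 9/2 * real (divisor_sigma 5 n) - 30/7 * real (divisor_sigma 7 n)"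
proof -
  \<comment> \<open>The factor 10 in \<open>f\<close> makes the a^3 b^3 terms cancel. Since f(d, d)
    = 9 d^6, the derivative term is 9 n sigma_5(n).\<close>
  have "quad_sum (int n) (\<lambda>a b x y.
      -58 * (real_of_int a ^ 1 * real_of_int b ^ 5)
      - 50 * (real_of_int a ^ 5 * real_of_int b ^ 1)) =
      (\<Sum>d | d dvd n. (real n / real d - 1) * (10 * real d ^ 3 * real d ^ 3 - real d * real d ^ 5)
        - (3/14 * real d + 9/2 * real d ^ 5 + 30/7 * real d ^ 7 - 9 * real d ^ 6))"
  proof (rule quad_sum_even_polynomial[OF assms,
      where f = "\<lambda>a b. 10 * a ^ 3 * b ^ 3 - a * b ^ 5"], goal_cases)
    case (5 d)
    have *: "?case \<longleftrightarrow>
        (\<Sum>b<d. 9 * real b ^ 6 + (30 * real d ^ 2) * real b ^ 4 + (10 * real d ^ 3) * real b ^ 3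
        - (30 * real d) * real b ^ 5 - real d ^ 5 * real b) =
        3/14 * real d + 9/2 * real d ^ 5 + 30/7 * real d ^ 7 - 9 * real d ^ 6"
      by (intro arg_cong2[of _ _ _ _ "(=)"] sum.cong refl) (simp add: algebra_simps eval_nat_numeral)
    show ?case
      unfolding * unfolding sum.distrib sum_subtractf sum_distrib_left[symmetric] sum_powers_lessThan
      by (simp add: field_simps eval_nat_numeral)
  qed (simp_all add: algebra_simps eval_nat_numeral)
  also have "\<dots> =
      (\<Sum>d | d dvd n. 9 * (real n * real d ^ 5) - 3/14 * real d ^ 1 - 9/2 * real d ^ 5 - 30/7 * real d ^ 7)"
    using assms by (intro sum.cong refl) (auto simp: field_simps eval_nat_numeral)
  also have "\<dots> = 9 * (real n * real (divisor_sigma 5 n)) - 3/14 * real (divisor_sigma 1 n)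
    - 9/2 * real (divisor_sigma 5 n) - 30/7 * real (divisor_sigma 7 n)"
    by (simp add: divisor_sigma_def sum.distrib sum_subtractf sum_distrib_left[symmetric]
        sum_divide_distrib[symmetric])
  finally show ?thesis
    unfolding quad_sum_add quad_sum_diff quad_sum_mult sigma_conv_eq_quad_sum
    using sigma_conv_commute[of 1 5 n] by simp
qed

lemma sigma_conv_3_7_5_5:
  assumes "n \<ge> 1"
  shows "-8 * sigma_conv 3 7 n - 10 * sigma_conv 5 5 n =
    1/60 * real (divisor_sigma 3 n) + 1/30 * real (divisor_sigma 7 n)
    - 5/126 * real (divisor_sigma 5 n) - 13/1260 * real (divisor_sigma 11 n)"
proof -
  \<comment> \<open>Since f(d, d) = 0, there is no n sigma_9(n). Also f(d - b, -b) = d (d - b)^4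
    b^5, so powers of b beyond the ninth do not occur. In view of Q^2 = E_8, the resulting ratio 8 :
    10 is that of 441 * 240 * 480 to 250 * 504^2 in 441 Q^3 + 250 R^2.\<close>
  have "quad_sum (int n) (\<lambda>a b x y.
      2 * (real_of_int a ^ 1 * real_of_int b ^ 9)
      + 12 * (real_of_int a ^ 3 * real_of_int b ^ 7)
      - 10 * (real_of_int a ^ 5 * real_of_int b ^ 5)
      - 20 * (real_of_int a ^ 7 * real_of_int b ^ 3)
      - 2 * (real_of_int a ^ 9 * real_of_int b ^ 1)) =
      (\<Sum>d | d dvd n. (real n / real d - 1) * (real d ^ 4 * real d ^ 6 - real d ^ 5 * real d ^ 5)
        - (5/126 * real d ^ 5 + 13/1260 * real d ^ 11 - 1/60 * real d ^ 3 - 1/30 * real d ^ 7))"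
  proof (rule quad_sum_even_polynomial[OF assms, where f = "\<lambda>a b. a ^ 4 * b ^ 6 - a ^ 5 * b ^ 5"],
      goal_cases)
    case (5 d)
    have *: "?case \<longleftrightarrow>
        (\<Sum>b<d. real d * real b ^ 9 + (6 * real d ^ 3) * real b ^ 7 + real d ^ 6 * real b ^ 4
        - (4 * real d ^ 2) * real b ^ 8 - (3 * real d ^ 4) * real b ^ 6
        - real d ^ 5 * real b ^ 5) =
        5/126 * real d ^ 5 + 13/1260 * real d ^ 11 - 1/60 * real d ^ 3 - 1/30 * real d ^ 7"
      by (intro arg_cong2[of _ _ _ _ "(=)"] sum.cong refl) (simp add: algebra_simps eval_nat_numeral)
    show ?case
      unfolding * unfolding sum.distrib sum_subtractf sum_distrib_left[symmetric] sum_powers_lessThan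
      by (simp add: field_simps eval_nat_numeral)
  qed (simp_all add: algebra_simps eval_nat_numeral)
  also have "\<dots> =
      (\<Sum>d | d dvd n. 1/60 * real d ^ 3 + 1/30 * real d ^ 7 - 5/126 * real d ^ 5 - 13/1260 * real d ^ 11)"
    using assms by (intro sum.cong refl) (auto simp: field_simps eval_nat_numeral)
  also have "\<dots> = 1/60 * real (divisor_sigma 3 n) + 1/30 * real (divisor_sigma 7 n)
    - 5/126 * real (divisor_sigma 5 n) - 13/1260 * real (divisor_sigma 11 n)"
    by (simp add: divisor_sigma_def sum.distrib sum_subtractf sum_distrib_left[symmetric]
        sum_divide_distrib[symmetric])
  finally show ?thesis
    unfolding quad_sum_add quad_sum_diff quad_sum_mult sigma_conv_eq_quad_sum
    using sigma_conv_commute[of 1 9 n] sigma_conv_commute[of 7 3 n] by simp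
qed

subsection \<open>The differential equation for the discriminant\<close>

unbundle no vec_syntax
unbundle fps_syntax

text \<open>The derivation q d/dq. The coefficient ring is left general because the product is
  treated over the integers and the Eisenstein series over the reals.\<close>

definition fps_theta :: "'a :: comm_ring_1 fps \<Rightarrow> 'a fps" where
  "fps_theta f = fps_X * fps_deriv f"

lemma fps_theta_nth: "fps_theta f $ n = of_nat n * f $ n"
  by (cases n) (simp_all add: fps_theta_def)

lemma fps_theta_add: "fps_theta (f + g) = fps_theta f + fps_theta g"
  and fps_theta_diff: "fps_theta (f - g) = fps_theta f - fps_theta g"
  and fps_theta_mult: "fps_theta (f * g) = fps_theta f * g + f * fps_theta g"
  and fps_theta_numeral: "fps_theta (numeral k) = 0"
  and fps_theta_1: "fps_theta 1 = 0"
  by (simp_all add: fps_theta_def algebra_simps)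

lemma fps_theta_X_power: "fps_theta (fps_X ^ m) = of_nat m * fps_X ^ m"
  by (rule fps_ext) (simp add: fps_theta_nth flip: fps_of_nat)

lemma fps_theta_power: "fps_theta (f ^ Suc k) = of_nat (Suc k) * f ^ k * fps_theta f"
  by (induction k) (simp_all add: fps_theta_mult algebra_simps)

text \<open>Logarithmic differentiation without division: \<open>g i\<close> stands for the
  logarithmic derivative of \<open>f i\<close>.\<close>

lemma fps_theta_prod_logarithmic:
  assumes "finite A" "\<And>i. i \<in> A \<Longrightarrow> fps_theta (f i) = f i * g i"
  shows "fps_theta (prod f A) = prod f A * sum g A"
  using assms by (induction A) (simp_all add: fps_theta_1 fps_theta_mult algebra_simps)

text \<open>The Lambert series r q^r / (1 - q^r), for r > 0; the guard \<open>m > 0\<close> removes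
  a constant term. Its multiple by -24 is the logarithmic derivative of (1 - q^r)^24 with respect to
  q d/dq.\<close>

definition fps_multiples :: "nat \<Rightarrow> int fps" where
  "fps_multiples r = Abs_fps (\<lambda>m. if m > 0 \<and> r dvd m then int r else 0)"

lemma fps_multiples_geometric:
  assumes "r > 0"
  shows "(1 - fps_X ^ r) * fps_multiples r = of_nat r * fps_X ^ r"
proof (rule fps_ext)
  fix m
  have "((1 - fps_X ^ r) * fps_multiples r) $ m =
      fps_multiples r $ m - (if m < r then 0 else fps_multiples r $ (m - r))"
    by (simp add: left_diff_distrib fps_X_power_mult_nth)
  also have "\<dots> = (if m = r then int r else 0)"
    using assms by (auto simp: fps_multiples_def dvd_minus_self dest: dvd_imp_le)
  also have "\<dots> = (of_nat r * fps_X ^ r) $ m"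
    by (simp add: fps_of_nat[symmetric])
  finally show "((1 - fps_X ^ r) * fps_multiples r) $ m = (of_nat r * fps_X ^ r :: int fps) $ m" .
qed

lemma fps_theta_eta_factor:
  assumes "r > 0"
  shows "fps_theta ((1 - fps_X ^ r) ^ 24) = (1 - fps_X ^ r) ^ 24 * (- 24 * fps_multiples r)"
proof -
  have "fps_theta ((1 - fps_X ^ r) ^ Suc 23 :: int fps) =
      - 24 * (1 - fps_X ^ r) ^ 23 * (of_nat r * fps_X ^ r)"
    by (simp only: fps_theta_power fps_theta_diff fps_theta_1 fps_theta_X_power) simp
  also have "\<dots> = (1 - fps_X ^ r) ^ Suc 23 * (- 24 * fps_multiples r)"
    by (simp only: fps_multiples_geometric[OF assms, symmetric] power_Suc) (simp add: algebra_simps)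
  moreover have "24 = Suc 23" by simp
  ultimately show ?thesis by metis
qed

text \<open>A junk value (the set of divisors of \<open>0\<close> is infinite) that makes the constant term of
  \<open>\<Sum>\<sigma>\<^sub>k(n)q^n\<close> vanish.\<close>

lemma divisor_sigma_0: "divisor_sigma k 0 = 0"
  by (simp add: divisor_sigma_def)

section \<open>The infinite product and its partial products\<close>

definition eta_partial_product :: "nat \<Rightarrow> int fps" where
  "eta_partial_product N = (\<Prod>r\<le>N. (1 - fps_X ^ Suc r) ^ 24)"

text \<open>Each coefficient is eventually constant in N, so one N serves all k \<le> m. The bound
  \<open>m \<le> N\<close> ensures that every positive divisor of such a k > 0 indexes a
  factor.\<close>

lemma ramanujan_tau_eta_partial_product:
  obtains N where "m \<le> N"
    "\<And>k. k \<le> m \<Longrightarrow> (fps_X * eta_partial_product N) $ k = ramanujan_tau k"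
proof -
  define L where "L = (\<Prod>r. (1 - fps_X ^ Suc r) ^ 24 :: int fps)"
  \<comment> \<open>No factor is zero, which excludes the case of \<open>has_prod\<close> in which
    the product is 0 and partial products start after a zero factor.\<close>
  have "(1 - fps_X ^ Suc r :: int fps) $ 0 \<noteq> 0" for r by simp
  hence "(1 - fps_X ^ Suc r) ^ 24 \<noteq> (0 :: int fps)" for r
    by (metis fps_zero_nth power_not_zero)
  hence "eta_partial_product \<longlonglongrightarrow> L"
    using ramanujan_tau_has_prod
    unfolding eta_partial_product_def [abs_def] L_def has_prod_def raw_has_prod_def by simp
  hence "\<forall>k. \<forall>\<^sub>F N in sequentially. eta_partial_product N $ k = L $ k"
    by (simp add: tendsto_fps_iff)
  hence "\<forall>\<^sub>F N in sequentially. (\<forall>k\<in>{..m}. eta_partial_product N $ k = L $ k) \<and> m \<le> N"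
    by (intro eventually_conj eventually_ball_finite eventually_ge_at_top) auto
  then obtain N where N: "\<And>k. k \<le> m \<Longrightarrow> eta_partial_product N $ k = L $ k" "m \<le> N"
    by (auto simp: eventually_sequentially)
  have "(fps_X * eta_partial_product N) $ k = ramanujan_tau k" if "k \<le> m" for k
    using that by (simp add: ramanujan_tau_def N L_def[symmetric] del: power_Suc)
  with N(2) show ?thesis by (rule that)
qed

lemma ramanujan_tau_1: "ramanujan_tau 1 = 1"
proof -
  obtain N where "(fps_X * eta_partial_product N) $ 1 = ramanujan_tau 1"
    using ramanujan_tau_eta_partial_product[of 1] by (metis order_refl)
  moreover have "eta_partial_product N $ 0 = 1"
    by (induction N) (simp_all add: eta_partial_product_def fps_nth_power_0 del: power_Suc)
  ultimately show ?thesis by simp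
qed

text \<open>The coefficient of q^m on either side depends only on coefficients up to m, so a long
  partial product can replace the infinite one. Its logarithmic derivative is a sum of Lambert
  series.\<close>

lemma fps_theta_ramanujan_tau:
  "fps_theta (Abs_fps ramanujan_tau) =
    Abs_fps ramanujan_tau * (1 - 24 * Abs_fps (\<lambda>n. int (divisor_sigma 1 n)))"
proof (rule fps_ext)
  fix m
  let ?P = eta_partial_product
  define G where "G = (\<lambda>N. \<Sum>r\<le>N. fps_multiples (Suc r))"
  obtain N where N: "m \<le> N" and XP: "\<And>k. k \<le> m \<Longrightarrow> (fps_X * ?P N) $ k = ramanujan_tau k"
    using ramanujan_tau_eta_partial_product[of m] by blast
  \<comment> \<open>The r-th Lambert series contributes r to the coefficient of q^k exactly when r
    divides k.\<close>
  have G: "G N $ k = int (divisor_sigma 1 k)" if "k \<le> m" for k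
  proof (cases "k = 0")
    case False
    have "G N $ k = (\<Sum>r\<in>Suc ` {..N}. if r dvd k then int r else 0)"
      using False by (simp add: G_def fps_sum_nth fps_multiples_def sum.reindex del: sum.cl_ivl_Suc)
    also have "\<dots> = (\<Sum>r | r dvd k. int r)"
    proof -
      have "r \<le> Suc N" if "r dvd k" for r
        using dvd_imp_le[OF that] False \<open>k \<le> m\<close> N by simp
      thus ?thesis
        using False unfolding image_Suc_atMost
        by (intro sum.mono_neutral_cong_right) (auto simp: Suc_le_eq dvd_pos_nat)
    qed
    finally show ?thesis by (simp add: divisor_sigma_def)
  qed (simp add: G_def fps_sum_nth fps_multiples_def divisor_sigma_0)
  have "fps_theta (?P N) = ?P N * (\<Sum>r\<le>N. - 24 * fps_multiples (Suc r))"
    unfolding eta_partial_product_def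
    by (rule fps_theta_prod_logarithmic) (auto simp: fps_theta_eta_factor simp del: power_Suc)
  also have "(\<Sum>r\<le>N. - 24 * fps_multiples (Suc r)) = - 24 * G N"
    unfolding G_def by (simp only: sum_distrib_left)
  finally have "fps_theta (fps_X * ?P N) = fps_X * ?P N * (1 - 24 * G N)"
    using fps_theta_X_power[of 1, where 'a = int] by (simp add: fps_theta_mult algebra_simps)
  hence "fps_theta (fps_X * ?P N) $ m = (fps_X * ?P N * (1 - 24 * G N)) $ m" by simp
  moreover have "fps_theta (fps_X * ?P N) $ m = fps_theta (Abs_fps ramanujan_tau) $ m"
    unfolding fps_theta_nth by (simp only: XP order_refl fps_nth_Abs_fps)
  moreover have "(fps_X * ?P N * (1 - 24 * G N)) $ m =
      (Abs_fps ramanujan_tau * (1 - 24 * Abs_fps (\<lambda>n. int (divisor_sigma 1 n)))) $ m"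
    unfolding fps_mult_nth[of _ "1 - _"]
    by (intro sum.cong refl arg_cong2[of _ _ _ _ "(*)"])
       (simp_all add: XP G numeral_fps_const del: fps_X_mult_nth)
  ultimately show "fps_theta (Abs_fps ramanujan_tau) $ m =
      (Abs_fps ramanujan_tau * (1 - 24 * Abs_fps (\<lambda>n. int (divisor_sigma 1 n)))) $ m"
    by simp
qed

subsection \<open>Eisenstein series\<close>

definition sigma_series :: "nat \<Rightarrow> real fps" where
  "sigma_series k = Abs_fps (\<lambda>n. real (divisor_sigma k n))"

lemma sigma_series_nth: "sigma_series k $ n = real (divisor_sigma k n)"
  by (simp add: sigma_series_def)

lemma sigma_series_mult_nth: "(sigma_series i * sigma_series j) $ n = sigma_conv i j n"
  unfolding fps_mult_nth sigma_conv_def sigma_series_nth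
  \<comment> \<open>The end terms of the Cauchy product vanish because \<open>divisor_sigma\<close>
    is 0 at 0.\<close>
  by (rule sum.mono_neutral_right) (auto simp: divisor_sigma_0 not_le)

lemma numeral_mult_fps_nth: "(numeral k * f) $ n = numeral k * f $ n"
  for f :: "'a :: comm_ring_1 fps"
  by (simp add: numeral_fps_const)

definition "tau_series = Abs_fps (\<lambda>n. real_of_int (ramanujan_tau n))"

lemma fps_theta_tau_series: "fps_theta tau_series = (1 - 24 * sigma_series 1) * tau_series"
proof (rule fps_ext)
  fix n
  have "real_of_int (fps_theta (Abs_fps ramanujan_tau) $ n) =
      real_of_int ((Abs_fps ramanujan_tau * (1 - 24 * Abs_fps (\<lambda>n. int (divisor_sigma 1 n)))) $ n)"
    by (simp only: fps_theta_ramanujan_tau)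
  also have "\<dots> = (tau_series * (1 - 24 * sigma_series 1)) $ n"
    unfolding fps_mult_nth[of _ "1 - _"] of_int_sum of_int_mult
    by (intro sum.cong refl)
       (simp add: tau_series_def sigma_series_def numeral_mult_fps_nth)
  also have "real_of_int (fps_theta (Abs_fps ramanujan_tau) $ n) = fps_theta tau_series $ n"
    by (simp add: fps_theta_nth tau_series_def)
  finally show "fps_theta tau_series $ n = ((1 - 24 * sigma_series 1) * tau_series) $ n"
    by (simp add: mult.commute)
qed

text \<open>Coefficientwise this is \<open>sigma_conv_3_1\<close> times -30, with n sigma_3(n) read
  as a derivative. The next two lemmas arise likewise, with factors -14/3 and -20/3.\<close>

lemma sigma_series_3_1:
  "240 * (sigma_series 3 * sigma_series 1) =
    21 * sigma_series 5 + 10 * sigma_series 3 - sigma_series 1 - 30 * fps_theta (sigma_series 3)"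
proof (rule fps_ext)
  fix n show "(240 * (sigma_series 3 * sigma_series 1)) $ n = (21 * sigma_series 5
      + 10 * sigma_series 3 - sigma_series 1 - 30 * fps_theta (sigma_series 3)) $ n"
  proof (cases "n = 0")
    case False
    thus ?thesis using sigma_conv_3_1[of n]
      by (simp add: numeral_mult_fps_nth fps_theta_nth sigma_series_mult_nth sigma_series_nth)
  qed (simp add: sigma_series_nth divisor_sigma_0 fps_theta_nth)
qed

lemma sigma_series_5_1:
  "504 * (sigma_series 5 * sigma_series 1) =
    sigma_series 1 + 21 * sigma_series 5 + 20 * sigma_series 7 - 42 * fps_theta (sigma_series 5)"
proof (rule fps_ext)
  fix n show "(504 * (sigma_series 5 * sigma_series 1)) $ n = (sigma_series 1
      + 21 * sigma_series 5 + 20 * sigma_series 7 - 42 * fps_theta (sigma_series 5)) $ n"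
  proof (cases "n = 0")
    case False
    thus ?thesis using sigma_conv_5_1[of n]
      by (simp add: numeral_mult_fps_nth fps_theta_nth sigma_series_mult_nth sigma_series_nth)
  qed (simp add: sigma_series_nth divisor_sigma_0 fps_theta_nth)
qed

lemma sigma_series_3_3:
  "120 * (sigma_series 3 * sigma_series 3) = sigma_series 7 - sigma_series 3"
proof (rule fps_ext)
  fix n show "(120 * (sigma_series 3 * sigma_series 3)) $ n = (sigma_series 7 - sigma_series 3) $ n"
  proof (cases "n = 0")
    case False
    thus ?thesis using sigma_conv_3_3[of n]
      by (simp add: numeral_mult_fps_nth sigma_series_mult_nth sigma_series_nth)
  qed (simp add: sigma_series_nth divisor_sigma_0)
qed

section \<open>Ramanujan's P, Q, R and their differential equations\<close>

definition eisenstein2 :: "real fps" where "eisenstein2 = 1 - 24 * sigma_series 1"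
definition eisenstein4 :: "real fps" where "eisenstein4 = 1 + 240 * sigma_series 3"
definition eisenstein6 :: "real fps" where "eisenstein6 = 1 - 504 * sigma_series 5"

lemma eisenstein4_squared: "eisenstein4 * eisenstein4 = 1 + 480 * sigma_series 7"
  using sigma_series_3_3 unfolding eisenstein4_def by algebra

text \<open>After expansion the product term is 24 * 240 times that of sigma_3 and sigma_1, so 24
  times \<open>sigma_series_3_1\<close> gives the claim. The equation for R follows from 24 times
  \<open>sigma_series_5_1\<close> in the same way.\<close>

lemma fps_theta_eisenstein4:
  "3 * fps_theta eisenstein4 = eisenstein2 * eisenstein4 - eisenstein6"
  using sigma_series_3_1
  unfolding eisenstein2_def eisenstein4_def eisenstein6_def fps_theta_add fps_theta_mult
    fps_theta_1 fps_theta_numeral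
  by algebra

lemma fps_theta_eisenstein6:
  "2 * fps_theta eisenstein6 = eisenstein2 * eisenstein6 - eisenstein4 * eisenstein4"
  using sigma_series_5_1
  unfolding eisenstein4_squared
  unfolding eisenstein2_def eisenstein6_def fps_theta_diff fps_theta_mult
    fps_theta_1 fps_theta_numeral
  by algebra

text \<open>The constant term of E_2 is 1, so comparing coefficients of q^n expresses (n - 1) f_n
  through f_i with i < n. Only f_1 is left free by this recurrence.\<close>

lemma fps_theta_eq_eisenstein2_mult_unique:
  assumes "fps_theta f = eisenstein2 * f" "f $ 1 = 0"
  shows "f = 0"
proof -
  have "f $ n = 0" for n
  proof (induction n rule: less_induct)
    case (less n)
    have "real n * f $ n = (f * eisenstein2) $ n"
      using assms(1) by (metis fps_theta_nth mult.commute)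
    also have "\<dots> = (\<Sum>i = 0..n. if i = n then f $ n else 0)"
      unfolding fps_mult_nth
      by (intro sum.cong refl)
         (auto simp: less eisenstein2_def numeral_mult_fps_nth sigma_series_nth divisor_sigma_0)
    finally have "(real n - 1) * f $ n = 0" by (simp add: algebra_simps)
    thus ?case using assms(2) by (cases "n = 1") auto
  qed
  thus ?thesis by (simp add: fps_ext)
qed

text \<open>Writing D for q d/dq, D(Q^3 - R^2) = 3 Q^2 DQ - 2 R DR = Q^2 (E_2 Q - R) - R (E_2 R -
  Q^2) = E_2 (Q^3 - R^2), the equation that the tau series satisfies.\<close>

lemma tau_series_eq_eisenstein:
  "1728 * tau_series = eisenstein4 ^ 3 - eisenstein6 ^ 2"
proof -
  define f where "f = 1728 * tau_series - (eisenstein4 ^ 3 - eisenstein6 ^ 2)"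
  have "fps_theta f = eisenstein2 * f"
    using fps_theta_eisenstein4 fps_theta_eisenstein6 fps_theta_tau_series
    unfolding f_def fps_theta_diff fps_theta_mult fps_theta_numeral power3_eq_cube power2_eq_square
      eisenstein2_def[symmetric]
    by algebra
  \<comment> \<open>The coefficient of q in Q^3 - R^2 is 3 * 240 + 2 * 504 = 1728.\<close>
  moreover have "f $ 1 = 0"
    by (simp add: f_def eisenstein4_def eisenstein6_def power3_eq_cube power2_eq_square
        numeral_mult_fps_nth fps_numeral_nth tau_series_def
        ramanujan_tau_1[simplified] sigma_series_nth divisor_sigma_def)
  ultimately have "f = 0" by (rule fps_theta_eq_eisenstein2_mult_unique)
  thus ?thesis by (simp add: f_def)
qed

subsection \<open>The two formulas\<close>

text \<open>Q^3 is expanded as Q E_8, so that only convolutions of two divisor sums appear.\<close>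

lemma ramanujan_tau_sigma_conv:
  assumes "n \<ge> 1"
  shows "1728 * real_of_int (ramanujan_tau n) =
    480 * real (divisor_sigma 7 n) + 240 * real (divisor_sigma 3 n) + 1008 * real (divisor_sigma 5 n)
    + 115200 * sigma_conv 3 7 n - 254016 * sigma_conv 5 5 n"
proof -
  have "1728 * tau_series = 480 * sigma_series 7 + 240 * sigma_series 3 + 1008 * sigma_series 5
      + 115200 * (sigma_series 3 * sigma_series 7) - 254016 * (sigma_series 5 * sigma_series 5)"
    using tau_series_eq_eisenstein eisenstein4_squared
    unfolding eisenstein6_def eisenstein4_def by algebra
  hence "(1728 * tau_series) $ n = (480 * sigma_series 7 + 240 * sigma_series 3
      + 1008 * sigma_series 5 + 115200 * (sigma_series 3 * sigma_series 7)
      - 254016 * (sigma_series 5 * sigma_series 5)) $ n" by simp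
  thus ?thesis
    by (simp add: numeral_mult_fps_nth sigma_series_mult_nth sigma_series_nth tau_series_def)
qed

text \<open>Symmetrizing gives a^3 b^7 + a^7 b^3 - 2 a^5 b^5 = (ab)^3 (a^2 - b^2)^2. This is
  symmetric and zero for a = b, so the part with b < a is half of the whole.\<close>

lemma sigma_conv_diff_eq_quad_sum:
  "sigma_conv 3 7 n - sigma_conv 5 5 n = quad_sum (int n) (\<lambda>a b x y. if b < a
     then (real_of_int a * real_of_int b) ^ 3 * (real_of_int a ^ 2 - real_of_int b ^ 2) ^ 2 else 0)"
proof -
  define h where "h = (\<lambda>a b. (real_of_int a * real_of_int b) ^ 3
      * (real_of_int a ^ 2 - real_of_int b ^ 2) ^ 2)"
  have h_commute: "h a b = h b a" for a b
    by (simp add: h_def power2_commute mult.commute)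
  have "2 * (sigma_conv 3 7 n - sigma_conv 5 5 n) =
      sigma_conv 3 7 n + sigma_conv 7 3 n - 2 * sigma_conv 5 5 n"
    using sigma_conv_commute[of 3 7 n] by simp
  also have "\<dots> = quad_sum (int n) (\<lambda>a b x y. h a b)"
    unfolding sigma_conv_eq_quad_sum[symmetric] quad_sum_add[symmetric] quad_sum_mult[symmetric]
      quad_sum_diff[symmetric]
    by (rule quad_sum_cong) (simp add: h_def algebra_simps eval_nat_numeral)
  also have "\<dots> = 2 * quad_sum (int n) (\<lambda>a b x y. if b < a then h a b else 0)"
  proof -
    have "quad_sum (int n) (\<lambda>a b x y. if a = b then h a b else 0) = quad_sum (int n) (\<lambda>a b x y. 0)"
      by (rule quad_sum_cong) (simp add: h_def)
    also have "\<dots> = 0" by (simp add: quad_sum_def)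
    finally have diag: "quad_sum (int n) (\<lambda>a b x y. if a = b then h a b else 0) = 0" .
    have "quad_sum (int n) (\<lambda>a b x y. if a < b then h a b else 0) =
        quad_sum (int n) (\<lambda>a b x y. if b < a then h a b else 0)"
      by (subst quad_sum_swap) (simp add: h_commute cong: if_cong)
    with diag show ?thesis
      using quad_sum_split[of "int n" "\<lambda>a b x y. h a b" "\<lambda>a b x y. a" "\<lambda>a b x y. b"] by simp
  qed
  finally show ?thesis unfolding h_def by simp
qed

text \<open>Group the solutions by (a, b). Each satisfies a + b \<le> ax + by = n and gcd(a, b)
  divides ax + by, so the conditions on the pairs lose no solution.\<close>

lemma quad_sum_eq_sum_pairs:
  "quad_sum (int n) (\<lambda>a b x y. if b < a then h a b else 0) =
    (\<Sum>(m1, m2) \<in> {(m1 :: int, m2 :: int).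
        m1 > m2 \<and> m2 \<ge> 1 \<and> m1 + m2 \<le> int n \<and> gcd m1 m2 dvd int n}.
      h m1 m2 * (\<Sum>(y1, y2) \<in> {(y1 :: int, y2 :: int).
        y1 \<ge> 1 \<and> y2 \<ge> 1 \<and> m1 * y1 + m2 * y2 = int n}. 1))"
proof -
  let ?A = "{t \<in> quads (int n). case t of (a, b, x, y) \<Rightarrow> b < a}"
  let ?M = "{(m1 :: int, m2 :: int). m1 > m2 \<and> m2 \<ge> 1 \<and> m1 + m2 \<le> int n \<and> gcd m1 m2 dvd int n}"
  define Y where "Y = (\<lambda>(m1, m2). {(y1 :: int, y2 :: int). y1 \<ge> 1 \<and> y2 \<ge> 1 \<and> m1 * y1 + m2 * y2 = int n})"
  have finM: "finite ?M"
    by (rule finite_subset[of _ "{1..int n} \<times> {1..int n}"]) auto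
  have finY: "finite (Y m)" if "m \<in> ?M" for m
  proof (rule finite_subset)
    show "Y m \<subseteq> (\<lambda>(a, b, x, y). (x, y)) ` quads (int n)"
      using that by (force simp: Y_def quads_def image_iff)
  qed (simp add: finite_quads)
  have "quad_sum (int n) (\<lambda>a b x y. if b < a then h a b else 0) = (\<Sum>(a, b, x, y)\<in>?A. h a b)"
    unfolding quad_sum_def by (subst sum.inter_filter[OF finite_quads]) (auto intro!: sum.cong)
  also have "\<dots> = (\<Sum>(m, y)\<in>Sigma ?M Y. h (fst m) (snd m))"
  proof (rule sum.reindex_bij_witness[of _ "\<lambda>((a, b), (x, y)). (a, b, x, y)"
            "\<lambda>(a, b, x, y). ((a, b), (x, y))"], goal_cases)
    case (2 t)
    then obtain a b x y where t: "t = (a, b, x, y)" "b < a" "0 < b" "0 < x" "0 < y"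
      "a * x + b * y = int n"
      by (auto simp: quads_def)
    have "a \<le> a * x" "b \<le> b * y" using t by (auto simp: mult_le_cancel_left1)
    hence "a + b \<le> int n" using t(6) by linarith
    moreover have "gcd a b dvd int n" unfolding t(6)[symmetric] by (intro dvd_add) simp_all
    ultimately show ?case using t by (simp add: Y_def)
  qed (auto simp: quads_def Y_def)
  also have "\<dots> = (\<Sum>m\<in>?M. \<Sum>y\<in>Y m. h (fst m) (snd m))"
    by (rule sum.Sigma[symmetric]) (use finM finY in auto)
  also have "\<dots> = (\<Sum>(m1, m2)\<in>?M. h m1 m2 * (\<Sum>(y1, y2)\<in>Y (m1, m2). 1))"
    by (intro sum.cong refl) (simp add: split_def)
  finally show ?thesis by (simp add: Y_def)
qed

theorem theorem1p10:
  fixes n :: nat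
  assumes "n \<ge> 1"
  shows "(real_of_int (ramanujan_tau n) =
      1 / (2^3 * 3^5 * 5 * 7) *
        (3 * 7 * 691 * real (divisor_sigma 3 n) + 2^3 * 5 * 691 * real (divisor_sigma 5 n)
          + 2 * 3 * 7 * 691 * real (divisor_sigma 7 n) - 13 * 241 * real (divisor_sigma 11 n))
      + 691 * 2^2 / 3^3 *
        (\<Sum>m = 1..n - 1. (real (divisor_sigma 3 m) * real (divisor_sigma 7 (n - m))
          - real (divisor_sigma 5 m) * real (divisor_sigma 5 (n - m)))))
    \<and> (real_of_int (ramanujan_tau n) =
      1 / (2^3 * 3^5 * 5 * 7) *
        (\<Sum>d | d dvd n. real d ^ 3 *
          (3 * 7 * 691 + 2^3 * 5 * 691 * real d ^ 2 + 2 * 3 * 7 * 691 * real d ^ 4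
            - 13 * 241 * real d ^ 8))
      + 691 * 2^2 / 3^3 *
        (\<Sum>(m1, m2) \<in> {(m1 :: int, m2 :: int).
              m1 > m2 \<and> m2 \<ge> 1 \<and> m1 + m2 \<le> int n \<and> gcd m1 m2 dvd int n}.
          (real_of_int m1 * real_of_int m2) ^ 3 * (real_of_int m1 ^ 2 - real_of_int m2 ^ 2) ^ 2 *
          (\<Sum>(y1, y2) \<in> {(y1 :: int, y2 :: int).
                y1 \<ge> 1 \<and> y2 \<ge> 1 \<and> m1 * y1 + m2 * y2 = int n}. 1)))"
    (is "?\<tau> = ?c * ?\<sigma> + ?e * ?conv \<and> ?\<tau> = ?c * ?div + ?e * ?pairs")
proof -
  have conv: "?conv = sigma_conv 3 7 n - sigma_conv 5 5 n"
    by (simp add: sigma_conv_def sum_subtractf)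
  have pairs: "?pairs = sigma_conv 3 7 n - sigma_conv 5 5 n"
    unfolding sigma_conv_diff_eq_quad_sum
    by (subst quad_sum_eq_sum_pairs) simp
  have "?div = (\<Sum>d | d dvd n. 3 * 7 * 691 * real d ^ 3 + 2^3 * 5 * 691 * real d ^ 5
      + 2 * 3 * 7 * 691 * real d ^ 7 - 13 * 241 * real d ^ 11)"
    by (intro sum.cong refl) (simp add: algebra_simps flip: power_add)
  also have "\<dots> = ?\<sigma>"
    unfolding sum.distrib sum_subtractf sum_distrib_left[symmetric] by (simp add: divisor_sigma_def)
  finally have div: "?div = ?\<sigma>" .
  \<comment> \<open>With A, B for the convolutions 3, 7 and 5, 5: 115200 A - 254016 B = 176896 (A -
    B) + 7712 (-8 A - 10 B). Here 176896 = 1728 * 691 * 4 / 27, and 7712 = 32 * 241 is the origin of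
    the factor 241.\<close>
  have "?\<tau> = ?c * ?\<sigma> + ?e * (sigma_conv 3 7 n - sigma_conv 5 5 n)"
    using ramanujan_tau_sigma_conv[OF assms] sigma_conv_3_7_5_5[OF assms] by (simp add: field_simps)
  thus ?thesis unfolding conv pairs div by blast
qed

end
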